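(* Let $q=p^r$ with $p\neq 2$ prime, $r\ge 1$, and $q\neq 5,9$. Put $\mathbb{F}_q'=\mathbb{F}_q[x]/(x^2+1)=\{a+bi\mid a,b\in\mathbb{F}_q\}$, $i^2=-1$. A map $\varphi:\mathbb{F}_q'\to\mathbb{F}_q'$ is an automorphism of $\mathbb{F}_q'$ with respect to $\Delta$ if and only if it is a finite composition of maps of the following four types: (1) $z\mapsto z+s$ with $s\in\mathbb{F}_q'$; (2) $a+bi\mapsto b+ai$; (3) $z\mapsto zy$ with $y$ a unit of $\mathbb{F}_q'$ such that $y\overline{y}=r'^2$ for some $r'\in\mathbb{F}_q^*$; (4) $a+bi\mapsto a^{p^j}+b^{p^j}i$ with $j\in\mathbb{N}$.
   Context: For a commutative ring $\mathcal{R}$ with $1$, let $\mathcal{R}'=\mathcal{R}[x]/(x^2+1)$, with $i$ the class of $x$; its elements are written uniquely as $a+bi$ with $a,b\in\mathcal{R}$, and $\mathcal{R}'$ is identified with $\mathcal{R}^2$ via $(a,b)\mapsto a+bi$. Put $\overline{a+bi}=a-bi$. The squared distance is $d^2(a+bi,c+di)=(a-c)^2+(b-d)^2\in\mathcal{R}$. Two points are at integral distance if their squared distance equals $t^2$ for some $t\in\mathcal{R}$ (so $0$ counts as an integral distance). Define $\Delta(u,v)=1$ if $u,v$ are at integral distance and $\Delta(u,v)=0$ otherwise. An automorphism of $\mathcal{R}'$ with respect to $\Delta$ is a bijection $\varphi:\mathcal{R}'\to\mathcal{R}'$ such that for all $a,b,c,d\in\mathcal{R}$: (i) $\Delta(a+bi,c+di)=\Delta(\varphi(a+bi),\varphi(c+di))$;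 and (ii) there exist $a',b',c',d'\in\mathcal{R}$ with $\{\varphi(a+bi+t(c+di))\mid t\in\mathcal{R}\}=\{a'+b'i+t(c'+d'i)\mid t\in\mathcal{R}\}$. *)

theory Defs
  imports "HOL-Computational_Algebra.Polynomial" "HOL-Library.Cardinality"
begin

text \<open>
  The ring \<open>R' = R[x]/(x\<^sup>2 + 1)\<close>, where \<open>AdjI a b\<close> stands for \<open>a + b i\<close> and \<open>i\<close> is the class
  of \<open>x\<close>. The lemmas about \<open>poly_at_i\<close> below show that this ring is the quotient: evaluation at
  \<open>i\<close> is a surjective ring homomorphism from \<open>R[x]\<close> whose kernel is the ideal generated by
  \<open>x\<^sup>2 + 1\<close>.
\<close>

datatype 'a adjoin_i = AdjI (re: 'a) (im: 'a)

instantiation adjoin_i :: (comm_ring_1) comm_ring_1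
begin

definition "0 = AdjI 0 0"
definition "1 = AdjI 1 0"
definition "z + w = AdjI (re z + re w) (im z + im w)"
definition "z - w = AdjI (re z - re w) (im z - im w)"
definition "- z = AdjI (- re z) (- im z)"
definition "z * w = AdjI (re z * re w - im z * im w) (re z * im w + im z * re w)"

instance
  by standard
    (auto simp: zero_adjoin_i_def one_adjoin_i_def plus_adjoin_i_def minus_adjoin_i_def
      uminus_adjoin_i_def times_adjoin_i_def algebra_simps intro: adjoin_i.expand)

end

lemmas adjoin_i_defs =
  zero_adjoin_i_def one_adjoin_i_def plus_adjoin_i_def minus_adjoin_i_def
  uminus_adjoin_i_def times_adjoin_i_def

definition of_base :: "'a::comm_ring_1 \<Rightarrow> 'a adjoin_i"
  where "of_base a = AdjI a 0"

definition conj_i :: "'a::comm_ring_1 adjoin_i \<Rightarrow> 'a adjoin_i"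
  where "conj_i z = AdjI (re z) (- im z)"

lemma AdjI_eq: "AdjI a b = of_base a + of_base b * AdjI 0 1"
  by (simp add: of_base_def adjoin_i_defs)

definition poly_at_i :: "'a::comm_ring_1 poly \<Rightarrow> 'a adjoin_i"
  where "poly_at_i p = poly (map_poly of_base p) (AdjI 0 1)"

lemma poly_at_i_0 [simp]: "poly_at_i 0 = 0"
  by (simp add: poly_at_i_def)

lemma poly_at_i_pCons [simp]:
  "poly_at_i (pCons a p) = of_base a + AdjI 0 1 * poly_at_i p"
  by (simp add: poly_at_i_def map_poly_pCons of_base_def zero_adjoin_i_def)

lemma poly_at_i_1: "poly_at_i 1 = 1"
  by (simp add: one_pCons of_base_def adjoin_i_defs)

lemma poly_at_i_add: "poly_at_i (p + q) = poly_at_i p + poly_at_i q"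
  by (induction p q rule: poly_induct2) (auto simp: of_base_def adjoin_i_defs algebra_simps)

lemma poly_at_i_smult: "poly_at_i (smult a p) = of_base a * poly_at_i p"
  by (induction p) (auto simp: of_base_def adjoin_i_defs algebra_simps)

lemma poly_at_i_mult: "poly_at_i (p * q) = poly_at_i p * poly_at_i q"
proof (induction p)
  case (pCons a p)
  have "of_base (0::'a) = 0" by (simp add: of_base_def zero_adjoin_i_def)
  with pCons show ?case
    by (simp add: poly_at_i_add poly_at_i_smult distrib_right mult.assoc)
qed simp

lemma poly_at_i_surj: "surj poly_at_i"
proof (rule surjI)
  show "poly_at_i [:re z, im z:] = z" for z :: "'a adjoin_i"
    by (cases z) (simp add: of_base_def adjoin_i_defs)
qed

lemma poly_at_i_kernel: "poly_at_i p = 0 \<longleftrightarrow> [:1, 0, 1:] dvd p"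
proof
  assume "[:1, 0, 1:] dvd p"
  then obtain q where "p = [:1, 0, 1:] * q" by (rule dvdE)
  moreover have "poly_at_i [:1, 0, 1:] = (0 :: 'a adjoin_i)"
    by (simp add: of_base_def adjoin_i_defs)
  ultimately show "poly_at_i p = 0" by (simp only: poly_at_i_mult mult_zero_left)
next
  assume zero: "poly_at_i p = 0"
  have "\<exists>a b q. p = [:a, b:] + [:1, 0, 1:] * q"
  proof (induction p)
    case 0
    have "(0 :: 'a poly) = [:0, 0:] + [:1, 0, 1:] * 0" by simp
    then show ?case by blast
  next
    case (pCons c p)
    then obtain a b q where "p = [:a, b:] + [:1, 0, 1:] * q" by blast
    then have "pCons c p = [:c - b, a:] + [:1, 0, 1:] * pCons b q"
      by (simp add: algebra_simps)
    then show ?case by blast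
  qed
  then obtain a b q where p: "p = [:a, b:] + [:1, 0, 1:] * q" by blast
  have "poly_at_i [:1, 0, 1:] = (0 :: 'a adjoin_i)"
    by (simp add: of_base_def adjoin_i_defs)
  then have "poly_at_i p = poly_at_i [:a, b:]"
    unfolding p by (simp only: poly_at_i_add poly_at_i_mult mult_zero_left add_0_right)
  also have "\<dots> = AdjI a b" by (simp add: of_base_def adjoin_i_defs)
  finally have "a = 0" "b = 0" using zero by (simp_all add: zero_adjoin_i_def)
  then have "p = [:1, 0, 1:] * q" by (simp only: p pCons_0_0 add_0_left)
  then show "[:1, 0, 1:] dvd p" by (rule dvdI)
qed

definition sq_dist :: "'a::comm_ring_1 adjoin_i \<Rightarrow> 'a adjoin_i \<Rightarrow> 'a"
  where "sq_dist u v = (re u - re v)\<^sup>2 + (im u - im v)\<^sup>2"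

definition integral_dist :: "'a::comm_ring_1 adjoin_i \<Rightarrow> 'a adjoin_i \<Rightarrow> bool"
  where "integral_dist u v \<longleftrightarrow> (\<exists>t. sq_dist u v = t\<^sup>2)"

definition Delta :: "'a::comm_ring_1 adjoin_i \<Rightarrow> 'a adjoin_i \<Rightarrow> nat"
  where "Delta u v = (if integral_dist u v then 1 else 0)"

text \<open>
  The direction vectors \<open>c + d i\<close> and \<open>c' + d' i\<close> are unrestricted; zero yields a single point.
\<close>

definition Delta_automorphism :: "('a::comm_ring_1 adjoin_i \<Rightarrow> 'a adjoin_i) \<Rightarrow> bool"
  where "Delta_automorphism \<phi> \<longleftrightarrow> bij \<phi> \<and>
    (\<forall>a b c d. Delta (AdjI a b) (AdjI c d) = Delta (\<phi> (AdjI a b)) (\<phi> (AdjI c d))) \<and>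
    (\<forall>a b c d. \<exists>a' b' c' d'.
      {\<phi> (AdjI a b + of_base t * AdjI c d) | t. True} =
      {AdjI a' b' + of_base t * AdjI c' d' | t. True})"

definition translation_maps :: "('a::comm_ring_1 adjoin_i \<Rightarrow> 'a adjoin_i) set"
  where "translation_maps = {(\<lambda>z. z + s) | s. True}"

definition swap_coords :: "'a::comm_ring_1 adjoin_i \<Rightarrow> 'a adjoin_i"
  where "swap_coords z = AdjI (im z) (re z)"

definition square_norm_mults :: "('a::field adjoin_i \<Rightarrow> 'a adjoin_i) set"
  where "square_norm_mults =
    {(\<lambda>z. z * y) | y. y dvd 1 \<and> (\<exists>r. r \<noteq> 0 \<and> y * conj_i y = of_base (r\<^sup>2))}"

definition frobenius_maps :: "nat \<Rightarrow> ('a::comm_ring_1 adjoin_i \<Rightarrow> 'a adjoin_i) set"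
  where "frobenius_maps p = {(\<lambda>z. AdjI (re z ^ (p ^ j)) (im z ^ (p ^ j))) | j. True}"

definition finite_composition_of :: "('b \<Rightarrow> 'b) set \<Rightarrow> ('b \<Rightarrow> 'b) \<Rightarrow> bool"
  where "finite_composition_of G f \<longleftrightarrow> (\<exists>fs. set fs \<subseteq> G \<and> f = foldr (\<circ>) fs id)"

end

theory Submission
  imports Defs "HOL-Number_Theory.Residues"
begin

text \<open>
  A bijection mapping lines to lines is semilinear up to a translation, so an automorphism is
  \<open>z \<mapsto> M (\<sigma> z) + s\<close> with \<open>M\<close> linear and \<open>\<sigma>\<close> a field automorphism, hence a Frobenius power. The
  quadratic form \<open>g = N \<circ> M\<close> then takes square values exactly where \<open>N = x\<^sup>2 + y\<^sup>2\<close> does, and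
  it must be shown that \<open>g\<close> is a multiple of \<open>N\<close>; then \<open>M\<close> is a similarity. Let \<open>m = (q - 1) / 2\<close>.

  If \<open>-1\<close> is not a square, Euler's criterion makes \<open>(x\<^sup>2 + 1)\<^sup>m\<close> and \<open>g(x, 1)\<^sup>m\<close> agree on all \<open>q\<close> points.
  They have degree less than \<open>q\<close>, so they are equal polynomials, and comparing logarithmic
  derivatives gives proportionality.

  If \<open>-1\<close> is a square, null coordinates turn \<open>N\<close> into \<open>u v\<close> and \<open>g(u, 1)\<close> into a quadratic
  \<open>h = a u\<^sup>2 + b u + c\<close> with \<open>h\<^sup>m = u\<^sup>m\<close> at all nonzero \<open>u\<close> that are not roots of \<open>h\<close>. Hence
  \<open>h (h\<^sup>m - u\<^sup>m) = L (u\<^bsup>q-1\<^esup> - 1)\<close> with \<open>L\<close> of degree at most 2, so \<open>F = h\<^bsup>m+1\<^esup>\<close> has no terms of degree 3 and 4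
  once \<open>m \<ge> 5\<close>; this is where \<open>q = 5\<close> and \<open>q = 9\<close> are excluded. As \<open>m + 1 = 1/2\<close> in the field,
  \<open>2 h F' = h' F\<close>, and comparing low coefficients yields \<open>c = 0\<close>
  if \<open>a \<noteq> 0\<close>. Then \<open>(a u + b)\<^sup>m = 1\<close> at more than \<open>m\<close> points, which is absurd; so \<open>a = 0\<close>, and
  \<open>c = 0\<close> follows by the substitution \<open>u \<mapsto> 1/u\<close>.
\<close>

hide_const (open) Module.smult UnivPoly.coeff UnivPoly.monom

subsection \<open>Squares in finite fields\<close>

lemma power_card_minus_one:
  fixes x :: "'a::{field, finite}"
  assumes "x \<noteq> 0"
  shows "x ^ (CARD('a) - 1) = 1"
proof -
  let ?N = "UNIV - {0 :: 'a}"
  have "(\<Prod>y\<in>?N. y) = (\<Prod>y\<in>?N. x * y)"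
    by (rule prod.reindex_bij_witness[of _ "\<lambda>y. x * y" "\<lambda>y. y / x"]) (use assms in auto)
  also have "\<dots> = x ^ (CARD('a) - 1) * (\<Prod>y\<in>?N. y)"
    by (simp add: prod.distrib card_Diff_singleton)
  finally show ?thesis by simp
qed

lemma power_card_eq_self:
  fixes x :: "'a::{field, finite}"
  shows "x ^ CARD('a) = x"
proof (cases "x = 0")
  case True
  have "CARD('a) > 0" by (simp add: card_gt_0_iff)
  with True show ?thesis by (simp add: power_0_left)
next
  case False
  have "x ^ (CARD('a) - 1) * x = x ^ CARD('a)"
    by (rule power_minus_mult) (simp add: card_gt_0_iff)
  with power_card_minus_one[OF False] show ?thesis by simp
qed

lemma of_nat_card_eq_0: "of_nat CARD('a::{field, finite}) = (0 :: 'a)"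
  by (simp add: of_nat_eq_0_iff_char_dvd CHAR_dvd_CARD)

text \<open>The nonzero squares \<open>T\<close> lie among the at most \<open>m\<close> roots
  \<open>S\<close> of X^m - 1. Squaring is at most two-to-one on the \<open>2 * m\<close> nonzero
  elements, so \<open>T\<close> has at least \<open>m\<close> elements and \<open>T = S\<close>. For
  a nonsquare, \<open>a ^ m\<close> is a square root of 1 other than 1.\<close>

lemma euler_criterion:
  fixes a :: "'a::{field, finite}"
  assumes card: "CARD('a) = 2 * m + 1" and "a \<noteq> 0"
  shows "a ^ m = (if \<exists>t. a = t\<^sup>2 then 1 else -1)"
proof -
  have sq: "(t\<^sup>2) ^ m = 1" if "t \<noteq> 0" for t :: 'a
    using power_card_minus_one[OF that] by (simp add: card flip: power_mult)
  have "CARD('a) \<ge> card {0 :: 'a, 1}" by (rule card_mono) auto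
  with card have "m > 0" by simp
  let ?P = "monom 1 m - 1 :: 'a poly"
  define T where "T = (\<lambda>t::'a. t\<^sup>2) ` (UNIV - {0})"
  define S where "S = {x :: 'a. poly ?P x = 0}"
  have deg: "degree ?P \<le> m"
    by (rule degree_diff_le) (simp_all add: degree_monom_le)
  have "coeff ?P m = 1" using \<open>m > 0\<close> by simp
  then have "?P \<noteq> 0" by (metis coeff_0 zero_neq_one)
  from card_poly_roots_bound[OF this] deg have S: "card S \<le> m" by (simp add: S_def)
  have TS: "T \<subseteq> S" by (auto simp: T_def S_def poly_monom sq)
  have "2 * m = card (UNIV - {0 :: 'a})"
    by (simp add: card card_Diff_singleton)
  also have "\<dots> \<le> card (\<Union>b\<in>T. {t. t\<^sup>2 = b})"
    by (rule card_mono) (auto simp: T_def)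
  also have "\<dots> \<le> (\<Sum>b\<in>T. card {t. t\<^sup>2 = b})"
    by (rule card_UN_le) simp
  also have "\<dots> \<le> (\<Sum>b\<in>T. 2)"
  proof (rule sum_mono)
    fix b assume "b \<in> T"
    then obtain t where "b = t\<^sup>2" by (auto simp: T_def)
    then have "{t. t\<^sup>2 = b} \<subseteq> {t, -t}" by (auto simp: power2_eq_iff)
    then have "card {t. t\<^sup>2 = b} \<le> card {t, -t}" by (rule card_mono[rotated]) simp
    also have "\<dots> \<le> 2" by (simp add: card_insert_if)
    finally show "card {t. t\<^sup>2 = b} \<le> 2" .
  qed
  finally have "m \<le> card T" by simp
  with S TS have "T = S" by (intro card_seteq) auto
  show ?thesis
  proof (cases "\<exists>t. a = t\<^sup>2")
    case True
    with sq \<open>a \<noteq> 0\<close> show ?thesis by auto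
  next
    case False
    then have "a \<notin> S" using \<open>T = S\<close> by (auto simp: T_def)
    then have "a ^ m \<noteq> 1" by (simp add: S_def poly_monom)
    moreover have "(a ^ m)\<^sup>2 = 1"
      using sq[OF \<open>a \<noteq> 0\<close>] by (simp flip: power_mult add: mult.commute)
    ultimately show ?thesis using False by (simp add: power2_eq_1_iff)
  qed
qed

lemma square_mult_square_iff:
  fixes r :: "'a::field"
  assumes "r \<noteq> 0"
  shows "(\<exists>t. r\<^sup>2 * z = t\<^sup>2) \<longleftrightarrow> (\<exists>t. z = t\<^sup>2)"
  using assms by (metis nonzero_mult_div_cancel_left power_divide power_mult_distrib zero_eq_power2)

lemma power_half_cong:
  fixes a b :: "'a::{field, finite}"
  assumes "CARD('a) = 2 * m + 1" "a \<noteq> 0" "b \<noteq> 0" "(\<exists>t. a = t\<^sup>2) \<longleftrightarrow> (\<exists>t. b = t\<^sup>2)"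
  shows "a ^ m = b ^ m"
  using assms by (simp add: euler_criterion)

lemma two_neq_0_of_odd_card:
  assumes "CARD('a::{field, finite}) = 2 * m + 1"
  shows "(2 :: 'a) \<noteq> 0"
  using of_nat_card_eq_0[where 'a = 'a] by (auto simp: assms)

subsection \<open>Binary quadratic forms with the same square values\<close>

lemma quadratic_same_squares_anisotropic:
  fixes a b c d :: "'a::{field, finite}"
  assumes card: "CARD('a) = 2 * m + 1"
    and nonsq: "\<And>i :: 'a. i\<^sup>2 \<noteq> -1"
    and squares: "\<And>x. (\<exists>t. x\<^sup>2 + 1 = t\<^sup>2) \<longleftrightarrow> (\<exists>t. a * x\<^sup>2 + b * x + c = t\<^sup>2)"
    and disc: "4 * a * c - b\<^sup>2 = d\<^sup>2" "d \<noteq> 0"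
  shows "b = 0 \<and> a = c"
proof -
  \<comment> \<open>In the field 2m + 1 = 0, so \<open>m\<close> is invertible and can be cancelled
    from the derivatives below.\<close>
  have m0: "of_nat m \<noteq> (0 :: 'a)"
  proof
    assume "of_nat m = (0 :: 'a)"
    with of_nat_card_eq_0[where 'a = 'a] show False by (simp add: card)
  qed
  have two: "(2 :: 'a) \<noteq> 0"
  proof
    assume "(2 :: 'a) = 0"
    then have "(1::'a)\<^sup>2 = -1" by (simp add: eq_neg_iff_add_eq_0)
    with nonsq show False by blast
  qed
  define f g where "f = [:1, 0, 1 :: 'a:]" and "g = [:c, b, a:]"
  have pf: "poly f x = x\<^sup>2 + 1" and pg: "poly g x = a * x\<^sup>2 + b * x + c" for x
    by (simp_all add: f_def g_def power2_eq_square algebra_simps)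
  have f0: "poly f x \<noteq> 0" for x
    using nonsq[of x] by (simp add: pf eq_neg_iff_add_eq_0)
  have g0: "poly g x \<noteq> 0" for x
  proof
    assume *: "poly g x = 0"
    \<comment> \<open>Completing the square: a root of \<open>g\<close> would make -1 the square of
      (2ax + b)/d.\<close>
    have "(2 * a * x + b)\<^sup>2 + d\<^sup>2 = 4 * a * poly g x"
      unfolding pg disc(1)[symmetric] by (simp add: power2_eq_square algebra_simps)
    with * have "(2 * a * x + b)\<^sup>2 = - d\<^sup>2" by (simp add: eq_neg_iff_add_eq_0)
    then have "((2 * a * x + b) / d)\<^sup>2 = -1"
      using disc(2) by (simp add: power_divide)
    with nonsq show False by blast
  qed
  \<comment> \<open>Both degrees are at most 2m, one less than the number of points of
    agreement.\<close>
  have fg: "f ^ m = g ^ m"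
  proof (rule poly_eqI_degree)
    show "poly (f ^ m) x = poly (g ^ m) x" for x
      unfolding poly_power
      using f0 g0 squares by (intro power_half_cong[OF card]) (auto simp: pf pg)
    have "degree f \<le> 2" "degree g \<le> 2" by (simp_all add: f_def g_def)
    then have "degree f * m \<le> 2 * m" "degree g * m \<le> 2 * m" by simp_all
    with degree_power_le[of f m] degree_power_le[of g m]
    show "degree (f ^ m) < card (UNIV :: 'a set)" "degree (g ^ m) < card (UNIV :: 'a set)"
      unfolding card by linarith+
  qed
  have "m \<noteq> 0" using m0 by (cases m) auto
  then have pw: "h ^ m = h ^ (m - 1) * h" for h :: "'a poly"
    by (metis mult.commute power_eq_if)
  from fg have "pderiv (f ^ m) = pderiv (g ^ m)" by simp
  then have "smult (of_nat m) (f ^ (m - 1) * pderiv f) = smult (of_nat m) (g ^ (m - 1) * pderiv g)"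
    by (simp only: pderiv_power)
  with m0 have "f ^ (m - 1) * pderiv f = g ^ (m - 1) * pderiv g"
    by (metis smult_eq_iff mult.commute divide_self_if)
  \<comment> \<open>Multiplying by \<open>f * g\<close> restores the exponent \<open>m\<close>, so
    the equal powers can be cancelled.\<close>
  then have "f ^ (m - 1) * pderiv f * (f * g) = g ^ (m - 1) * pderiv g * (f * g)" by simp
  then have "f ^ m * (pderiv f * g) = g ^ m * (pderiv g * f)"
    unfolding pw by (simp only: mult_ac)
  moreover have "g ^ m \<noteq> 0" unfolding fg[symmetric] by (simp add: f_def)
  ultimately have "pderiv f * g = pderiv g * f"
    unfolding fg by (metis mult_left_cancel)
  then have coeffs: "coeff (pderiv f * g) n = coeff (pderiv g * f) n" for n by simp
  \<comment> \<open>Degree 1 gives 2c = 2a, and degree 2 gives 2b = b.\<close>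
  have "(2 :: 'a) \<noteq> 1"
    by (metis add_cancel_right_right one_add_one one_neq_zero)
  with two coeffs[of 1] coeffs[of 2] show ?thesis
    by (simp add: f_def g_def pderiv_pCons numeral_2_eq_2)
qed

lemma quadratic_same_squares_leading_coeff_0:
  fixes a b c :: "'a::{field, finite}"
  assumes card: "CARD('a) = 2 * m + 1" and m: "m \<ge> 5"
    and disc: "b\<^sup>2 - 4 * a * c \<noteq> 0"
    and squares: "\<And>u. u \<noteq> 0 \<Longrightarrow> a * u\<^sup>2 + b * u + c \<noteq> 0 \<Longrightarrow>
      (\<exists>t. u = t\<^sup>2) \<longleftrightarrow> (\<exists>t. a * u\<^sup>2 + b * u + c = t\<^sup>2)"
  shows "a = 0"
proof (rule ccontr)
  assume a: "a \<noteq> 0"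
  note two = two_neq_0_of_odd_card[OF card]
  define h where "h = [:c, b, a:]"
  define P where "P = h ^ m - monom 1 m"
  define W where "W = (monom 1 (2 * m) - 1 :: 'a poly)"
  define L where "L = h * P div W"
  have ph: "poly h u = a * u\<^sup>2 + b * u + c" for u
    by (simp add: h_def power2_eq_square algebra_simps)
  have hm: "poly h u ^ m = u ^ m" if "u \<noteq> 0" "poly h u \<noteq> 0" for u
    using that squares by (intro power_half_cong[OF card]) (auto simp: ph)
  \<comment> \<open>At a nonzero root of \<open>h\<close> the two powers differ; the factor
    \<open>h\<close> takes care of these points.\<close>
  then have hP: "poly (h * P) u = 0" if "u \<noteq> 0" for u
    using that by (auto simp: P_def poly_monom)
  have W: "poly W u = 0" if "u \<noteq> 0" for u
    using power_card_minus_one[OF that] by (simp add: W_def poly_monom card)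
  have degW: "degree W = 2 * m"
  proof (rule antisym)
    show "degree W \<le> 2 * m"
      unfolding W_def by (rule degree_diff_le) (simp_all add: degree_monom_le)
    show "2 * m \<le> degree W" using m by (intro le_degree) (simp add: W_def)
  qed
  then have "W \<noteq> 0" using m by auto
  \<comment> \<open>A nonzero remainder would have degree below 2m but vanish at all 2m nonzero
    elements.\<close>
  have "h * P mod W = 0"
  proof (rule ccontr)
    assume R: "h * P mod W \<noteq> 0"
    have "poly (h * P mod W) u = 0" if "u \<noteq> 0" for u
      using hP[OF that] W[OF that] by (metis add_0 div_mult_mod_eq mult_zero_right poly_add poly_mult)
    then have "card (UNIV - {0 :: 'a}) \<le> card {u. poly (h * P mod W) u = 0}"
      by (intro card_mono) auto
    also have "\<dots> \<le> degree (h * P mod W)" by (rule card_poly_roots_bound[OF R])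
    also have "\<dots> < 2 * m" using degree_mod_less'[OF \<open>W \<noteq> 0\<close> R] degW by simp
    finally show False by (simp add: card card_Diff_singleton)
  qed
  then have LW: "h * P = L * W" unfolding L_def by (metis add.right_neutral div_mult_mod_eq)
  have "degree L \<le> 2"
  proof (cases "L = 0")
    case False
    have "degree h \<le> 2" by (simp add: h_def)
    then have "degree h * m \<le> 2 * m" by simp
    with degree_power_le[of h m] have "degree (h ^ m) \<le> 2 * m" by linarith
    moreover have "degree (monom 1 m :: 'a poly) \<le> 2 * m"
      using degree_monom_le[of "1 :: 'a" m] by linarith
    ultimately have "degree P \<le> 2 * m" unfolding P_def by (rule degree_diff_le)
    with \<open>degree h \<le> 2\<close> degree_mult_le[of h P] have "degree (h * P) \<le> 2 + 2 * m" by linarith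
    then show ?thesis
      using False \<open>W \<noteq> 0\<close> by (simp add: LW degree_mult_eq degW)
  next
    case True
    show ?thesis unfolding True by simp
  qed
  define F where "F = h ^ (m + 1)"
  have F: "F = monom 1 m * h + monom 1 (2 * m) * L - L"
    using LW by (simp add: F_def P_def W_def algebra_simps)
  \<comment> \<open>\<open>L\<close> has degree at most 2, and the other two summands start in
    degree m >= 5 or later.\<close>
  have F_coeff: "coeff F k = 0" if "k = 3 \<or> k = 4" for k
    using that m \<open>degree L \<le> 2\<close> by (auto simp: F coeff_monom_mult coeff_eq_0)
  \<comment> \<open>2(m + 1) is q + 1, which is 1 in the field; this removes the factor m + 1 that
    differentiating \<open>F\<close> produces.\<close>
  have "of_nat (2 * (m + 1)) = (1 :: 'a)"
    using of_nat_card_eq_0[where 'a = 'a] by (simp add: card algebra_simps)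
  then have half: "2 * of_nat (m + 1) = (1 :: 'a)" by simp
  have "smult 2 (h * pderiv F) = smult (2 * of_nat (m + 1)) (h * h ^ m * pderiv h)"
    by (simp only: F_def pderiv_power add_diff_cancel_right' mult_smult_right smult_smult mult.assoc)
  then have "smult 2 (h * pderiv F) = F * pderiv h"
    by (simp only: half smult_1_left) (simp add: F_def)
  then have "coeff (smult 2 (h * pderiv F)) n = coeff (pderiv h * F) n" for n
    by (simp add: mult.commute)
  \<comment> \<open>Degrees 0, 1 and 3 are compared. In degree 3 the vanishing of the coefficients 3
    and 4 of \<open>F\<close> leaves only coefficient 2, which is forced to be 0. The other two
    equations then eliminate coefficient 1, and the discriminant appears as a factor.\<close>
  note eqs = this[of 0] this[of "Suc 0"] this[of "Suc (Suc (Suc 0))"]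
  define F0 F1 F2 where "F0 = coeff F 0" "F1 = coeff F (Suc 0)" "F2 = coeff F (Suc (Suc 0))"
  have "coeff F (Suc (Suc (Suc 0))) = 0" "coeff F (Suc (Suc (Suc (Suc 0)))) = 0"
    by (rule F_coeff; simp)+
  with eqs have E: "2 * c * F1 = b * F0" "2 * (2 * c * F2 + b * F1) = 2 * a * F0 + b * F1"
      "2 * a * (2 * F2) = 2 * a * F2"
    by (simp_all add: h_def pderiv_pCons coeff_pderiv F0_F1_F2_def algebra_simps)
  from E(3) have "2 * a * F2 = 0" by Groebner_Basis.algebra
  with a two have "F2 = 0" by simp
  with E(2) have "b * F1 = 2 * a * F0" by Groebner_Basis.algebra
  with E(1) have "(b\<^sup>2 - 4 * a * c) * F0 = 0" by Groebner_Basis.algebra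
  with disc have "F0 = 0" by simp
  moreover have "F0 = c ^ (m + 1)"
    unfolding F0_F1_F2_def F_def by (simp flip: poly_0_coeff_0 add: h_def)
  ultimately have "c ^ (m + 1) = 0" by metis
  then have c: "c = 0" by (rule power_eq_0_iff[THEN iffD1, THEN conjunct1])
  with disc have "b \<noteq> 0" by auto
  \<comment> \<open>As \<open>c = 0\<close>, h = u k, so h^m = u^m becomes k^m = 1 away from 0 and
    the root of \<open>k\<close>. These are more than m points, too many for the degree m of
    \<open>k ^ m\<close>.\<close>
  define k where "k = [:b, a:]"
  have hk: "poly h u = u * poly k u" for u
    by (simp add: h_def k_def c)
  have dk: "degree (k ^ m) = m"
    by (subst degree_power_eq) (use a in \<open>simp_all add: k_def\<close>)
  let ?A = "UNIV - {0, - b / a}"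
  have "card ?A \<ge> 2 * m - 1"
    by (simp add: card_Diff_subset card card_insert_if)
  then have cA: "card ?A > m" using m by linarith
  have "k ^ m = 1"
  proof (rule poly_eqI_degree[where A = ?A])
    fix u assume "u \<in> ?A"
    then have u: "u \<noteq> 0" and "poly k u \<noteq> 0"
      using a by (auto simp: k_def field_simps eq_neg_iff_add_eq_0)
    then have "poly h u \<noteq> 0" by (simp add: hk)
    from hm[OF u this] u show "poly (k ^ m) u = poly 1 u"
      by (simp add: hk power_mult_distrib)
  qed (use cA dk in simp_all)
  with dk m show False by simp
qed

lemma quadratic_same_squares_split:
  fixes a b c :: "'a::{field, finite}"
  assumes card: "CARD('a) = 2 * m + 1" and m: "m \<ge> 5"
    and disc: "b\<^sup>2 - 4 * a * c \<noteq> 0"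
    and squares: "\<And>u. u \<noteq> 0 \<Longrightarrow> a * u\<^sup>2 + b * u + c \<noteq> 0 \<Longrightarrow>
      (\<exists>t. u = t\<^sup>2) \<longleftrightarrow> (\<exists>t. a * u\<^sup>2 + b * u + c = t\<^sup>2)"
  shows "a = 0 \<and> c = 0"
proof
  show "a = 0" using assms by (rule quadratic_same_squares_leading_coeff_0)
  show "c = 0"
  proof (rule quadratic_same_squares_leading_coeff_0[OF card m])
    show "b\<^sup>2 - 4 * c * a \<noteq> 0" using disc by (simp add: mult_ac)
    fix v assume v: "v \<noteq> 0" and nz: "c * v\<^sup>2 + b * v + a \<noteq> 0"
    have sq_div: "(\<exists>t. z / w\<^sup>2 = t\<^sup>2) \<longleftrightarrow> (\<exists>t. z = t\<^sup>2)" if "w \<noteq> 0" for z w :: 'a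
      using square_mult_square_iff[of "1 / w" z] that by (simp add: power_divide)
    \<comment> \<open>Setting u = 1/v reverses the coefficients up to the square v^2, and 1/v
      differs from v by a square as well.\<close>
    have e: "a * (1 / v)\<^sup>2 + b * (1 / v) + c = (c * v\<^sup>2 + b * v + a) / v\<^sup>2"
      using v by (simp add: field_simps power2_eq_square)
    have "(\<exists>t. 1 / v = t\<^sup>2) \<longleftrightarrow> (\<exists>t. a * (1 / v)\<^sup>2 + b * (1 / v) + c = t\<^sup>2)"
      by (rule squares) (use v nz in \<open>simp_all only: e, simp_all\<close>)
    moreover have "1 / v = v / v\<^sup>2" using v by (simp add: power2_eq_square)
    then have "(\<exists>t. 1 / v = t\<^sup>2) \<longleftrightarrow> (\<exists>t. v = t\<^sup>2)"
      using sq_div[OF v, of v] by simp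
    ultimately show "(\<exists>t. v = t\<^sup>2) \<longleftrightarrow> (\<exists>t. c * v\<^sup>2 + b * v + a = t\<^sup>2)"
      by (simp only: e sq_div[OF v])
  qed
qed

lemma same_squares_imp_proportional:
  fixes a b c d :: "'a::{field, finite}"
  assumes "odd CARD('a)" and "CARD('a) \<noteq> 5" "CARD('a) \<noteq> 9"
    and squares: "\<And>x y. (\<exists>t. x\<^sup>2 + y\<^sup>2 = t\<^sup>2) \<longleftrightarrow> (\<exists>t. a * x\<^sup>2 + b * x * y + c * y\<^sup>2 = t\<^sup>2)"
    and disc: "4 * a * c - b\<^sup>2 = d\<^sup>2" "d \<noteq> 0"
  shows "b = 0 \<and> a = c"
proof -
  from assms obtain m where card: "CARD('a) = 2 * m + 1" by (elim oddE)
  note two = two_neq_0_of_odd_card[OF card]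
  show ?thesis
  proof (cases "\<exists>i :: 'a. i\<^sup>2 = -1")
    case False
    have "(\<exists>t. x\<^sup>2 + 1 = t\<^sup>2) \<longleftrightarrow> (\<exists>t. a * x\<^sup>2 + b * x + c = t\<^sup>2)" for x
      using squares[of x 1] by simp
    with False card disc show ?thesis by (intro quadratic_same_squares_anisotropic) auto
  next
    case True
    then obtain i :: 'a where i: "i\<^sup>2 = -1" by blast
    then have i': "i\<^sup>2 + 1 = 0" by simp
    have "CARD('a) \<ge> card {0 :: 'a, 1}" by (rule card_mono) auto
    \<comment> \<open>As -1 is a square, m is even; excluding m = 2 (q = 5) and m = 4 (q = 9) leaves
      m >= 6.\<close>
    have "(-1 :: 'a) ^ m = 1"
      using euler_criterion[OF card, of "-1"] i by (metis neg_0_equal_iff_equal zero_neq_one)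
    with two have "even m" using minus_one_power_iff[of m, where 'a = 'a]
      by (metis add_neg_numeral_special(8) add.right_inverse one_add_one)
    with card assms \<open>CARD('a) \<ge> card {0 :: 'a, 1}\<close> have m: "m \<ge> 5" by (auto elim!: evenE)
    \<comment> \<open>These are the coefficients of 4 times the form at the point with null
      coordinates x + i y = u and x - i y = 1, where x^2 + y^2 = u.\<close>
    define A B C where "A = a - c - i * b" "B = 2 * (a + c)" "C = a - c + i * b"
    have "A = 0 \<and> C = 0"
    proof (rule quadratic_same_squares_split[OF card m])
      have "B\<^sup>2 - 4 * A * C = 4 * (4 * a * c - b\<^sup>2)"
        unfolding A_B_C_def using i' by Groebner_Basis.algebra
      also have "\<dots> = (2 * d)\<^sup>2" unfolding disc by simp
      finally show "B\<^sup>2 - 4 * A * C \<noteq> 0"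
        using disc(2) two by (metis mult_eq_0_iff zero_eq_power2)
      fix u :: 'a
      define x y where "x = (u + 1) / 2" "y = - i * (u - 1) / 2"
      have xy: "2 * x = u + 1" "2 * y = - i * (u - 1)"
        using two by (simp_all add: x_y_def)
      have "4 * (x\<^sup>2 + y\<^sup>2) = 4 * u"
        using xy i' by Groebner_Basis.algebra
      moreover have four: "(4 :: 'a) \<noteq> 0" using two by (metis mult_2 mult_eq_0_iff numeral_Bit0)
      ultimately have 1: "x\<^sup>2 + y\<^sup>2 = u" by (metis mult_left_cancel)
      have 2: "2\<^sup>2 * (a * x\<^sup>2 + b * x * y + c * y\<^sup>2) = A * u\<^sup>2 + B * u + C"
        unfolding A_B_C_def using xy i' by Groebner_Basis.algebra
      have "(\<exists>t. 2\<^sup>2 * z = t\<^sup>2) \<longleftrightarrow> (\<exists>t. z = t\<^sup>2)" for z :: 'a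
        using two by (rule square_mult_square_iff)
      with squares[of x y] show "(\<exists>t. u = t\<^sup>2) \<longleftrightarrow> (\<exists>t. A * u\<^sup>2 + B * u + C = t\<^sup>2)"
        unfolding 1 2[symmetric] by (simp only:)
    qed
    then have "2 * (a - c) = 0" "2 * (i * b) = 0" unfolding A_B_C_def by Groebner_Basis.algebra+
    moreover have "i \<noteq> 0" using i by auto
    ultimately show ?thesis using two by simp
  qed
qed

subsection \<open>Automorphisms of finite fields\<close>

lemma prime_power_card_imp_CHAR:
  assumes "prime p" "CARD('a::{field, finite}) = p ^ r"
  shows "CHAR('a) = p"
proof -
  have "prime CHAR('a)" by (rule prime_CHAR_semidom) (simp add: finite_imp_CHAR_pos)
  moreover from this have "CHAR('a) dvd p"
    using CHAR_dvd_CARD[where 'a = 'a] assms(2) by (metis prime_dvd_power)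
  ultimately show ?thesis using assms(1) by (metis primes_dvd_imp_eq)
qed

text \<open>The type is repackaged as a record so that the cyclicity of the multiplicative group of
  a finite field, proved in HOL-Algebra, applies.\<close>

lemma multiplicative_generator_exists:
  "\<exists>g :: 'a::{field, finite}. \<forall>x. x \<noteq> 0 \<longrightarrow> (\<exists>n. x = g ^ n)"
proof -
  define R where "R = \<lparr>carrier = (UNIV :: 'a set), monoid.mult = (*), one = 1 :: 'a, zero = 0 :: 'a, add = (+)\<rparr>"
  have "cring R"
  proof (intro cringI abelian_groupI comm_monoidI)
    show "\<exists>y\<in>carrier R. y \<oplus>\<^bsub>R\<^esub> x = \<zero>\<^bsub>R\<^esub>" for x
      by (auto simp: R_def intro!: exI[of _ "-x"])
  qed (auto simp: R_def algebra_simps)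
  moreover have "Units R = carrier R - {\<zero>\<^bsub>R\<^esub>}"
    by (auto simp: R_def Units_def) (metis left_inverse right_inverse)
  ultimately interpret R: field R by (rule cring.cring_fieldI)
  have pow: "x [^]\<^bsub>R\<^esub> n = x ^ n" for x and n :: nat
    by (induction n) (simp_all add: R_def nat_pow_def)
  have "finite (carrier R)" by (simp add: R_def)
  from R.finite_field_mult_group_has_gen[OF this] obtain g
    where "carrier (mult_of R) = {g [^]\<^bsub>R\<^esub> i | i :: nat. i \<in> UNIV}" by blast
  moreover have "carrier (mult_of R) = UNIV - {0}" by (simp add: R_def)
  ultimately show ?thesis unfolding pow by blast
qed

text \<open>\<open>map_poly h\<close> is itself multiplicative, so it acts factor by factor. This
  serves both Frobenius and \<open>\<sigma>\<close> below.\<close>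

lemma map_poly_prod_linear:
  fixes h :: "'a::comm_ring_1 \<Rightarrow> 'a"
  assumes "\<And>x y. h (x + y) = h x + h y" "\<And>x y. h (x * y) = h x * h y" "h 1 = 1"
  shows "map_poly h (\<Prod>j\<in>J. [:- a j, 1:]) = (\<Prod>j\<in>J. [:- h (a j), 1:])"
proof -
  have h0: "h 0 = 0" using assms(1)[of 0 0] by simp
  then have hm: "h (- x) = - h x" for x using assms(1)[of x "- x"] by (simp add: minus_unique)
  have hs: "h (sum f A) = (\<Sum>x\<in>A. h (f x))" for f and A :: "nat set"
    by (induction A rule: infinite_finite_induct) (simp_all add: h0 assms)
  have mult: "map_poly h (p * q) = map_poly h p * map_poly h q" for p q
    by (rule poly_eqI) (simp add: coeff_map_poly h0 coeff_mult hs assms)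
  show ?thesis
    by (induction J rule: infinite_finite_induct)
      (simp_all add: mult map_poly_pCons h0 hm assms(3) map_poly_1 del: mult_pCons_left mult_pCons_right)
qed

text \<open>
  For a generator \<open>g\<close>, Frobenius permutes the factors of \<open>f = (X - g) (X - g\<^sup>p) \<dots>\<close>, so \<open>f\<close> has
  coefficients in the prime field and is fixed by \<open>\<sigma>\<close>. Thus \<open>g\<close> is also a root of the product of
  the \<open>X - \<sigma>(g)\<^bsup>p^j\<^esup>\<close>.
\<close>

lemma ring_hom_eq_frobenius_power:
  fixes \<sigma> :: "'a::{field, finite} \<Rightarrow> 'a"
  assumes "prime p" "CARD('a) = p ^ r"
    and hom: "\<And>x y. \<sigma> (x + y) = \<sigma> x + \<sigma> y" "\<And>x y. \<sigma> (x * y) = \<sigma> x * \<sigma> y" "\<sigma> 1 = 1"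
  shows "\<exists>j. \<forall>x. \<sigma> x = x ^ (p ^ j)"
proof -
  note char = prime_power_card_imp_CHAR[OF assms(1,2)]
  obtain g :: 'a where g: "\<And>x. x \<noteq> 0 \<Longrightarrow> \<exists>n. x = g ^ n"
    using multiplicative_generator_exists by blast
  have \<sigma>0: "\<sigma> 0 = 0" using hom(1)[of 0 0] by (metis add_cancel_right_right add_0_right)
  have \<sigma>_pow: "\<sigma> (x ^ n) = \<sigma> x ^ n" for x n by (induction n) (simp_all add: hom)
  define f where "f = (\<Prod>j<r. [:- (g ^ p ^ j), 1:])"
  have card: "x ^ p ^ r = x" for x :: 'a
    using power_card_eq_self[of x] by (simp add: assms(2))
  have "map_poly (\<lambda>x. x ^ p) f = (\<Prod>j<r. [:- (g ^ p ^ Suc j), 1:])"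
    unfolding f_def
    by (subst map_poly_prod_linear)
      (use assms(1) char in \<open>simp_all add: freshmans_dream power_mult_distrib flip: power_mult add: mult.commute\<close>)
  also have "\<dots> = (\<Prod>j\<in>{1..r}. [:- (g ^ p ^ j), 1:])"
    by (rule prod.reindex_bij_witness[of _ "\<lambda>j. j - 1" Suc]) auto
  \<comment> \<open>The factor for exponent index 0 has been replaced by the one for r, and they
    agree because g^(p^r) = g.\<close>
  also have "\<dots> = f"
  proof (cases r)
    case (Suc k)
    have "f = [:- g, 1:] * (\<Prod>j\<in>{1..k}. [:- (g ^ p ^ j), 1:])"
      unfolding f_def Suc by (subst prod.lessThan_Suc_shift) (simp add: prod.atLeast1_atMost_eq)
    moreover have "(\<Prod>j\<in>{1..r}. [:- (g ^ p ^ j), 1:]) = [:- g, 1:] * (\<Prod>j\<in>{1..k}. [:- (g ^ p ^ j), 1:])"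
      using card[of g] by (simp add: Suc)
    ultimately show ?thesis by simp
  qed (simp add: f_def)
  finally have frob: "map_poly (\<lambda>x. x ^ p) f = f" .
  \<comment> \<open>The values of \<open>of_nat\<close> below p are p distinct fixed points of
    Frobenius, and X^p - X has no further roots. Each of them is fixed by
    \<open>\<sigma>\<close>.\<close>
  have fixed: "\<sigma> c = c" if "c ^ p = c" for c
  proof -
    have p: "p > 1" using assms(1) by (rule prime_gt_1_nat)
    let ?Q = "monom 1 p - [:0, 1:] :: 'a poly"
    have "degree ?Q \<le> p"
      by (rule degree_diff_le) (use p in \<open>simp_all add: degree_monom_le\<close>)
    moreover have "coeff ?Q p = 1" using p by (simp add: coeff_pCons split: nat.split)
    then have "?Q \<noteq> 0" by (metis coeff_0 zero_neq_one)
    ultimately have le: "card {x :: 'a. x ^ p = x} \<le> p"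
      using card_poly_roots_bound[of ?Q] by (simp add: poly_monom)
    have nat_pow: "of_nat n ^ p = (of_nat n :: 'a)" for n
      by (induction n) (use p assms(1) char in \<open>simp_all add: freshmans_dream\<close>)
    have "inj_on (of_nat :: nat \<Rightarrow> 'a) {..<p}"
    proof (rule linorder_inj_onI)
      fix m n assume "m < n" "n \<in> {..<p}"
      then have "\<not> p dvd (n - m)" by (auto dest: dvd_imp_le)
      with \<open>m < n\<close> show "of_nat m \<noteq> (of_nat n :: 'a)"
        by (metis char less_imp_le of_nat_diff of_nat_eq_0_iff_char_dvd right_minus_eq)
    qed auto
    then have "card (of_nat ` {..<p} :: 'a set) = p" by (simp add: card_image)
    with le nat_pow have "of_nat ` {..<p} = {x :: 'a. x ^ p = x}"
      by (intro card_seteq) auto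
    with that obtain n where "c = of_nat n" by blast
    moreover have "\<sigma> (of_nat n) = of_nat n" for n by (induction n) (simp_all add: hom \<sigma>0)
    ultimately show ?thesis by simp
  qed
  have "map_poly \<sigma> f = f"
  proof (rule poly_eqI)
    fix n
    have "p > 0" using assms(1) by (rule prime_gt_0_nat)
    then have "coeff f n ^ p = coeff f n"
      using arg_cong[OF frob, of "\<lambda>f. coeff f n"] by (simp add: coeff_map_poly)
    then show "coeff (map_poly \<sigma> f) n = coeff f n"
      by (simp add: coeff_map_poly \<sigma>0 fixed)
  qed
  moreover have "map_poly \<sigma> f = (\<Prod>j<r. [:- (\<sigma> g ^ p ^ j), 1:])"
    unfolding f_def by (subst map_poly_prod_linear) (simp_all add: hom \<sigma>_pow)
  ultimately have eq: "poly (\<Prod>j<r. [:- (\<sigma> g ^ p ^ j), 1:]) g = poly f g" by simp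
  have "CARD('a) \<ge> card {0 :: 'a, 1}" by (rule card_mono) auto
  with assms(2) have "r > 0" by (cases r) auto
  then have "poly f g = 0" by (auto simp: f_def poly_prod intro!: bexI[of _ 0])
  with eq obtain j where "j < r" and j: "g = \<sigma> g ^ p ^ j" by (auto simp: poly_prod)
  \<comment> \<open>A further r - j Frobenius steps complete the cycle of length r, which solves for
    \<open>\<sigma> g\<close>.\<close>
  have "g ^ p ^ (r - j) = \<sigma> g ^ p ^ r"
    by (subst j) (use \<open>j < r\<close> in \<open>simp flip: power_mult power_add\<close>)
  then have \<sigma>g: "\<sigma> g = g ^ p ^ (r - j)" by (simp add: card)
  have "\<sigma> x = x ^ p ^ (r - j)" for x
  proof (cases "x = 0")
    case True
    then show ?thesis using prime_gt_0_nat[OF assms(1)] by (simp add: \<sigma>0)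
  next
    case False
    then obtain n where "x = g ^ n" using g by blast
    then show ?thesis by (simp add: \<sigma>_pow \<sigma>g flip: power_mult add: mult.commute)
  qed
  then show ?thesis by blast
qed

lemma frobenius_facts:
  fixes F :: "'a::{field, finite} \<Rightarrow> 'a"
  assumes "prime p" "CARD('a) = p ^ r" and F: "F = (\<lambda>x. x ^ p ^ j)"
  shows frobenius_add: "F (x + y) = F x + F y"
    and frobenius_diff: "F (x - y) = F x - F y"
    and frobenius_bij: "bij F"
    and frobenius_square_iff: "(\<exists>t. F z = t\<^sup>2) \<longleftrightarrow> (\<exists>t. z = t\<^sup>2)"
proof -
  note char = prime_power_card_imp_CHAR[OF assms(1,2)]
  show add: "F (x + y) = F x + F y" for x y
    unfolding F by (rule freshmans_dream') (simp_all add: char assms(1))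
  show diff: "F (x - y) = F x - F y" for x y
    using add[of "x - y" y] by simp
  have "inj F"
  proof (rule injI)
    fix x y assume "F x = F y"
    with diff[of x y] have "F (x - y) = 0" by simp
    then show "x = y" by (simp add: F)
  qed
  then show "bij F" by (simp add: bij_def finite_UNIV_inj_surj)
  then have "surj F" by (simp add: bij_is_surj)
  have sq: "F (t\<^sup>2) = (F t)\<^sup>2" for t by (simp add: F flip: power_mult add: mult.commute)
  show "(\<exists>t. F z = t\<^sup>2) \<longleftrightarrow> (\<exists>t. z = t\<^sup>2)"
  proof
    assume "\<exists>t. F z = t\<^sup>2"
    then obtain t where "F z = F t ^ 2" using \<open>surj F\<close> by (metis surjD)
    with \<open>inj F\<close> show "\<exists>t. z = t\<^sup>2" by (metis sq injD)
  qed (auto simp: sq)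
qed

subsection \<open>Collineations of the affine plane\<close>

lemma adjoin_i_eq_iff: "z = w \<longleftrightarrow> re z = re w \<and> im z = im w"
  by (cases z; cases w) simp

lemma adjoin_i_sel_simps [simp]:
  fixes z w :: "'a::comm_ring_1 adjoin_i"
  shows "re (0 :: 'a adjoin_i) = 0" "im (0 :: 'a adjoin_i) = 0"
    "re (1 :: 'a adjoin_i) = 1" "im (1 :: 'a adjoin_i) = 0"
    "re (z + w) = re z + re w" "im (z + w) = im z + im w"
    "re (z - w) = re z - re w" "im (z - w) = im z - im w"
    "re (- z) = - re z" "im (- z) = - im z"
    "re (z * w) = re z * re w - im z * im w" "im (z * w) = re z * im w + im z * re w"
    "re (of_base a :: 'a adjoin_i) = a" "im (of_base a :: 'a adjoin_i) = 0"
    "of_base (0 :: 'a) = 0" "of_base (1 :: 'a) = 1"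
    "re (conj_i z) = re z" "im (conj_i z) = - im z"
    "re (swap_coords z) = im z" "im (swap_coords z) = re z"
  by (simp_all add: adjoin_i_defs of_base_def conj_i_def swap_coords_def)

text \<open>As in the automorphism condition, \<open>c = 0\<close> is allowed; nondegeneracy of
  image lines has to come from injectivity.\<close>

definition line :: "'a::comm_ring_1 adjoin_i \<Rightarrow> 'a adjoin_i \<Rightarrow> 'a adjoin_i set"
  where "line a c = range (\<lambda>t. a + of_base t * c)"

lemma lineI: "a + of_base t * c \<in> line a c"
  by (simp add: line_def)

lemma start_in_line: "a \<in> line a c"
  using lineI[of a 0 c] by simp

lemma end_in_line: "a + c \<in> line a c"
  using lineI[of a 1 c] by simp

lemma line_eqI:
  fixes a :: "'a::field adjoin_i"
  assumes "u \<in> line a c" "u + w \<in> line a c" "w \<noteq> 0"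
  shows "line a c = line u w"
proof -
  from assms obtain s t where s: "u = a + of_base s * c" and t: "u + w = a + of_base t * c"
    by (auto simp: line_def)
  then have w: "w = of_base (t - s) * c"
    by (simp add: adjoin_i_eq_iff algebra_simps)
  with \<open>w \<noteq> 0\<close> have "t - s \<noteq> 0" by (auto simp: adjoin_i_eq_iff)
  have uw: "u + of_base x * w = a + of_base (s + x * (t - s)) * c" for x
    by (simp add: w s adjoin_i_eq_iff algebra_simps)
  moreover have "a + of_base x * c = u + of_base ((x - s) / (t - s)) * w" for x
    unfolding uw using \<open>t - s \<noteq> 0\<close> by simp
  ultimately show ?thesis unfolding line_def by (metis (no_types, lifting) rangeI image_subsetI subset_antisym)
qed

lemma image_line:
  assumes "\<And>t. f (a + of_base t * c) = a' + of_base t * c'"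
  shows "f ` line a c = line a' c'"
  by (simp add: line_def image_image assms)

text \<open>
  Disjoint lines have disjoint images, so the parallels to the kernel of \<open>f\<close> go to parallels.
\<close>

lemma collineation_respects_linear_form:
  fixes \<psi> :: "'a::field adjoin_i \<Rightarrow> 'a adjoin_i"
  assumes "inj \<psi>" and lines: "\<And>a c. \<exists>a' c'. \<psi> ` line a c = line a' c'"
    and f: "f = (\<lambda>z. k * re z + l * im z)" "k \<noteq> 0 \<or> l \<noteq> 0"
    and kernel: "\<psi> ` {z. f z = 0} = {z. f z = 0}"
    and eq: "f z = f w"
  shows "f (\<psi> z) = f (\<psi> w)"
proof (cases "f z = 0")
  case True
  with eq have "\<psi> z \<in> \<psi> ` {z. f z = 0}" "\<psi> w \<in> \<psi> ` {z. f z = 0}" by auto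
  then show ?thesis unfolding kernel by simp
next
  case False
  \<comment> \<open>\<open>c\<close> spans the kernel of \<open>f\<close>, so
    \<open>line z c\<close> is the parallel through \<open>z\<close>. Its image misses the kernel,
    which forces \<open>f\<close> to vanish on the image direction.\<close>
  define c where "c = AdjI (- l) k"
  obtain a' c' where im: "\<psi> ` line z c = line a' c'" using lines by blast
  have fl: "f (a + of_base t * d) = f a + t * f d" for a t d
    by (simp add: f algebra_simps)
  have "f c = 0" by (simp add: f c_def)
  have "f (a' + of_base t * c') \<noteq> 0" for t
  proof
    assume "f (a' + of_base t * c') = 0"
    then have "a' + of_base t * c' \<in> \<psi> ` {z. f z = 0} \<inter> \<psi> ` line z c"
      unfolding kernel im by (simp add: lineI)
    with \<open>inj \<psi>\<close> obtain x where "f x = 0" "x \<in> line z c"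
      by (auto simp: image_Int[symmetric] inj_on_def)
    with \<open>f c = 0\<close> False show False by (auto simp: line_def fl)
  qed
  from this[of "- f a' / f c'"] have "f c' = 0" by (simp add: fl split: if_splits)
  then have const: "f x = f a'" if "x \<in> \<psi> ` line z c" for x
    using that unfolding im by (auto simp: line_def fl)
  have "w \<in> line z c"
  proof (cases "k = 0")
    case True
    with f eq have "w = z + of_base ((re z - re w) / l) * c"
      by (simp add: adjoin_i_eq_iff c_def)
    then show ?thesis by (metis lineI)
  next
    case False
    with f eq have "w = z + of_base ((im w - im z) / k) * c"
      by (simp add: adjoin_i_eq_iff c_def field_simps)
    then show ?thesis by (metis lineI)
  qed
  then show ?thesis using start_in_line[of z c] const by simp
qed

text \<open>Both axes and the diagonal are preserved, hence so are the three families of parallels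
  to them. The axes give coordinatewise action, and the diagonal makes both coordinate maps the same
  \<open>\<sigma>\<close>. Additivity holds because (x, x + y) and (0, y) lie on a parallel to the
  diagonal, multiplicativity because (x, xy) lies on the line through 0 and (1, y).\<close>

lemma collineation_fixing_frame:
  fixes \<psi> :: "'a::field adjoin_i \<Rightarrow> 'a adjoin_i"
  assumes inj: "inj \<psi>" and lines: "\<And>a c. \<exists>a' c'. \<psi> ` line a c = line a' c'"
    and fixes_frame: "\<psi> 0 = 0" "\<psi> 1 = 1" "\<psi> (AdjI 0 1) = AdjI 0 1"
  obtains \<sigma> where "\<And>x y. \<sigma> (x + y) = \<sigma> x + \<sigma> y" "\<And>x y. \<sigma> (x * y) = \<sigma> x * \<sigma> y" "\<sigma> 1 = 1"
    "\<And>x y. \<psi> (AdjI x y) = AdjI (\<sigma> x) (\<sigma> y)"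
proof -
  have line0: "\<psi> ` line 0 c = line 0 (\<psi> c)" if "c \<noteq> 0" for c
  proof -
    obtain a' c' where im: "\<psi> ` line 0 c = line a' c'" using lines by blast
    have "\<psi> 0 \<in> \<psi> ` line 0 c" "\<psi> c \<in> \<psi> ` line 0 c"
      using start_in_line end_in_line[of 0 c] by auto
    moreover have "\<psi> c \<noteq> 0" using that inj fixes_frame(1) by (metis injD)
    ultimately show ?thesis unfolding im by (intro line_eqI) (simp_all add: fixes_frame)
  qed
  have axes: "line 0 1 = {z :: 'a adjoin_i. 0 * re z + 1 * im z = 0}"
    "line 0 (AdjI 0 1) = {z :: 'a adjoin_i. 1 * re z + 0 * im z = 0}"
    "line 0 (AdjI 1 1) = {z :: 'a adjoin_i. (-1) * re z + 1 * im z = 0}"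
    by (auto simp: line_def image_iff adjoin_i_eq_iff)
  have im: "im (\<psi> z) = im (\<psi> w)" if "im z = im w" for z w
    using collineation_respects_linear_form[OF inj lines refl, of 0 1 z w] line0[of 1] that
    unfolding axes[symmetric] by (simp add: fixes_frame)
  have re: "re (\<psi> z) = re (\<psi> w)" if "re z = re w" for z w
    using collineation_respects_linear_form[OF inj lines refl, of 1 0 z w] line0[of "AdjI 0 1"] that
    unfolding axes[symmetric] by (simp add: fixes_frame adjoin_i_eq_iff)
  have "\<psi> (AdjI 1 1) = AdjI 1 1"
    using im[of "AdjI 1 1" "AdjI 0 1"] re[of "AdjI 1 1" 1] by (simp add: fixes_frame adjoin_i_eq_iff)
  then have diagonal: "\<psi> ` line 0 (AdjI 1 1) = line 0 (AdjI 1 1)"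
    using line0[of "AdjI 1 1"] by (simp add: zero_adjoin_i_def)
  have diff: "im (\<psi> z) - re (\<psi> z) = im (\<psi> w) - re (\<psi> w)" if "im z - re z = im w - re w" for z w
    using collineation_respects_linear_form[OF inj lines refl, of "-1" 1 z w] diagonal that
    unfolding axes[symmetric] by (simp add: algebra_simps)
  define \<sigma> where "\<sigma> x = re (\<psi> (AdjI x 0))" for x
  have \<psi>: "\<psi> (AdjI x y) = AdjI (\<sigma> x) (\<sigma> y)" for x y
  proof -
    have "re (\<psi> (AdjI x y)) = \<sigma> x" unfolding \<sigma>_def by (rule re) simp
    moreover have "im (\<psi> (AdjI x y)) = im (\<psi> (AdjI y y))" by (rule im) simp
    moreover have "im (\<psi> (AdjI y y)) = re (\<psi> (AdjI y y))"
      using diff[of "AdjI y y" 0] by (simp add: fixes_frame)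
    moreover have "re (\<psi> (AdjI y y)) = \<sigma> y" unfolding \<sigma>_def by (rule re) simp
    ultimately show ?thesis by (simp add: adjoin_i_eq_iff)
  qed
  have \<sigma>01: "\<sigma> 0 = 0" "\<sigma> 1 = 1"
    using fixes_frame(1,2) by (simp_all add: \<sigma>_def zero_adjoin_i_def one_adjoin_i_def)
  show thesis
  proof
    show "\<sigma> (x + y) = \<sigma> x + \<sigma> y" for x y
      using diff[of "AdjI x (x + y)" "AdjI 0 y"] by (simp add: \<psi> \<sigma>01 algebra_simps)
    show "\<sigma> (x * y) = \<sigma> x * \<sigma> y" for x y
    proof -
      have "AdjI x (x * y) = 0 + of_base x * AdjI 1 y" by (simp add: adjoin_i_eq_iff)
      then have "\<psi> (AdjI x (x * y)) \<in> \<psi> ` line 0 (AdjI 1 y)" by (metis imageI lineI)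
      then have "AdjI (\<sigma> x) (\<sigma> (x * y)) \<in> line 0 (AdjI 1 (\<sigma> y))"
        by (subst (asm) line0) (simp_all add: \<psi> \<sigma>01 adjoin_i_eq_iff)
      then show ?thesis by (auto simp: line_def adjoin_i_eq_iff)
    qed
  qed (fact \<sigma>01 \<psi>)+
qed

text \<open>An affine change of coordinates on the target reduces this to a map fixing 0, 1 and i.
  It is invertible, since dependent \<open>u\<close> and \<open>v\<close> would give the two axes
  the same image.\<close>

lemma collineation_semilinear:
  fixes \<phi> :: "'a::field adjoin_i \<Rightarrow> 'a adjoin_i"
  assumes inj: "inj \<phi>" and lines: "\<And>a c. \<exists>a' c'. \<phi> ` line a c = line a' c'"
  obtains \<sigma> s u v where "\<And>x y. \<sigma> (x + y) = \<sigma> x + \<sigma> y" "\<And>x y. \<sigma> (x * y) = \<sigma> x * \<sigma> y" "\<sigma> 1 = 1"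
    "re u * im v - im u * re v \<noteq> 0"
    "\<And>x y. \<phi> (AdjI x y) = of_base (\<sigma> x) * u + of_base (\<sigma> y) * v + s"
proof -
  define s u v where "s = \<phi> 0" "u = \<phi> 1 - s" "v = \<phi> (AdjI 0 1) - s"
  define D where "D = re u * im v - im u * re v"
  have "\<phi> 1 \<noteq> \<phi> 0" "\<phi> (AdjI 0 1) \<noteq> \<phi> 0"
    using inj by (simp_all add: inj_eq zero_adjoin_i_def one_adjoin_i_def)
  then have uv: "u \<noteq> 0" "v \<noteq> 0" by (simp_all add: s_u_v_def)
  have D: "D \<noteq> 0"
  proof
    assume "D = 0"
    then have *: "re u * im v = im u * re v" by (simp add: D_def)
    have "v = of_base (if re u = 0 then im v / im u else re v / re u) * u"
      using * uv by (auto simp: adjoin_i_eq_iff field_simps)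
    then have "line s u = line s v"
      by (metis line_eqI lineI start_in_line uv(2))
    moreover have axis: "\<phi> ` line 0 c = line s (\<phi> c - s)" if "\<phi> c - s \<noteq> 0" for c
    proof -
      obtain a' c' where im: "\<phi> ` line 0 c = line a' c'" using lines by blast
      have "\<phi> 0 \<in> \<phi> ` line 0 c" "\<phi> c \<in> \<phi> ` line 0 c"
        using start_in_line end_in_line[of 0 c] by auto
      with that show ?thesis unfolding im by (intro line_eqI) (simp_all add: s_u_v_def)
    qed
    ultimately have "\<phi> ` line 0 1 = \<phi> ` line 0 (AdjI 0 1)"
      using uv by (simp add: s_u_v_def)
    then have "line 0 1 = line 0 (AdjI 0 (1 :: 'a))"
      using inj by (simp add: inj_image_eq_iff)
    then have "0 + 1 \<in> line 0 (AdjI 0 (1 :: 'a))" using end_in_line by metis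
    then show False by (auto simp: line_def adjoin_i_eq_iff)
  qed
  \<comment> \<open>Coordinates with respect to the basis \<open>u\<close>, \<open>v\<close>, by
    Cramer's rule.\<close>
  define N where "N w = AdjI ((re w * im v - im w * re v) / D) ((re u * im w - im u * re w) / D)" for w
  have N_eq: "w = of_base (re (N w)) * u + of_base (im (N w)) * v" for w
    using D by (simp add: N_def adjoin_i_eq_iff divide_simps) (simp add: D_def algebra_simps)
  have N_lin: "N (a + of_base t * c - s) = N (a - s) + of_base t * N c" for a t c
    using D by (simp add: N_def adjoin_i_eq_iff field_simps)
  define \<psi> where "\<psi> z = N (\<phi> z - s)" for z
  have "inj \<psi>"
  proof (rule injI)
    fix z w assume "\<psi> z = \<psi> w"
    then have "\<phi> z - s = \<phi> w - s" using N_eq unfolding \<psi>_def by metis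
    with inj show "z = w" by (simp add: inj_eq)
  qed
  moreover have "\<exists>a' c'. \<psi> ` line a c = line a' c'" for a c
  proof -
    obtain a' c' where "\<phi> ` line a c = line a' c'" using lines by blast
    then have "\<psi> ` line a c = (\<lambda>w. N (w - s)) ` line a' c'"
      by (metis (no_types, lifting) \<psi>_def image_cong image_image)
    also have "\<dots> = line (N (a' - s)) (N c')" by (rule image_line) (rule N_lin)
    finally show ?thesis by blast
  qed
  moreover have "\<psi> 0 = 0" "\<psi> 1 = 1" "\<psi> (AdjI 0 1) = AdjI 0 1"
  proof -
    have "\<psi> 0 = N 0" "\<psi> 1 = N u" "\<psi> (AdjI 0 1) = N v" by (simp_all add: \<psi>_def s_u_v_def)
    with D show "\<psi> 0 = 0" "\<psi> 1 = 1" "\<psi> (AdjI 0 1) = AdjI 0 1"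
      by (simp_all add: N_def adjoin_i_eq_iff) (simp_all add: D_def mult.commute)
  qed
  ultimately obtain \<sigma> where \<sigma>: "\<And>x y. \<sigma> (x + y) = \<sigma> x + \<sigma> y" "\<And>x y. \<sigma> (x * y) = \<sigma> x * \<sigma> y" "\<sigma> 1 = 1"
    and \<psi>: "\<And>x y. \<psi> (AdjI x y) = AdjI (\<sigma> x) (\<sigma> y)"
    by (rule collineation_fixing_frame) (rule that)
  have "\<phi> (AdjI x y) = of_base (\<sigma> x) * u + of_base (\<sigma> y) * v + s" for x y
    using N_eq[of "\<phi> (AdjI x y) - s"] \<psi>[of x y] by (simp add: \<psi>_def algebra_simps)
  with \<sigma> D show thesis unfolding D_def by (rule that)
qed

subsection \<open>Automorphisms with respect to integral distance\<close>

lemma Delta_automorphism_iff: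
  "Delta_automorphism \<phi> \<longleftrightarrow> bij \<phi> \<and>
    (\<forall>z w. integral_dist (\<phi> z) (\<phi> w) \<longleftrightarrow> integral_dist z w) \<and>
    (\<forall>a c. \<exists>a' c'. \<phi> ` line a c = line a' c')"
proof -
  have all: "(\<forall>z. P z) \<longleftrightarrow> (\<forall>a b. P (AdjI a b))" and ex: "(\<exists>z. P z) \<longleftrightarrow> (\<exists>a b. P (AdjI a b))"
    for P :: "'a adjoin_i \<Rightarrow> bool"
    by (metis adjoin_i.exhaust)+
  have set: "{f t | t. True} = range f" for f :: "'a \<Rightarrow> 'a adjoin_i" by auto
  show ?thesis
    unfolding Delta_automorphism_def all ex set line_def image_image
    by (auto simp: Delta_def)
qed

section \<open>Compositions and the four types of generators\<close>

lemma Delta_automorphism_comp: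
  assumes "Delta_automorphism f" "Delta_automorphism g"
  shows "Delta_automorphism (f \<circ> g)"
  using assms unfolding Delta_automorphism_iff image_comp[symmetric]
  by (auto simp: bij_comp) metis

lemma Delta_automorphism_id: "Delta_automorphism id"
  unfolding Delta_automorphism_iff by auto

lemma Delta_automorphism_translation: "Delta_automorphism (\<lambda>z. z + s)"
  unfolding Delta_automorphism_iff
proof (intro conjI allI)
  show "bij (\<lambda>z. z + s)"
    by (rule bij_betw_byWitness[where f' = "\<lambda>z. z - s"]) auto
  show "integral_dist (z + s) (w + s) = integral_dist z w" for z w
    by (simp add: integral_dist_def sq_dist_def)
  have "(\<lambda>z. z + s) ` line a c = line (a + s) c" for a c
    by (rule image_line) (simp add: algebra_simps)
  then show "\<exists>a' c'. (\<lambda>z. z + s) ` line a c = line a' c'" for a c by blast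
qed

lemma Delta_automorphism_swap_coords: "Delta_automorphism swap_coords"
  unfolding Delta_automorphism_iff
proof (intro conjI allI)
  show "bij swap_coords"
    by (rule bij_betw_byWitness[where f' = swap_coords]) (auto simp: adjoin_i_eq_iff)
  show "integral_dist (swap_coords z) (swap_coords w) = integral_dist z w" for z w :: "'a adjoin_i"
    by (simp add: integral_dist_def sq_dist_def add.commute)
  have "swap_coords ` line a c = line (swap_coords a) (swap_coords c)" for a c :: "'a adjoin_i"
    by (rule image_line) (simp add: adjoin_i_eq_iff)
  then show "\<exists>a' c'. swap_coords ` line a c = line a' c'" for a c :: "'a adjoin_i" by blast
qed

lemma Delta_automorphism_square_norm_mult:
  fixes y :: "'a::field adjoin_i"
  assumes "y dvd 1" "r \<noteq> 0" "y * conj_i y = of_base (r\<^sup>2)"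
  shows "Delta_automorphism (\<lambda>z. z * y)"
  unfolding Delta_automorphism_iff
proof (intro conjI allI)
  from \<open>y dvd 1\<close> obtain y' where y': "y * y' = 1" by (metis dvdE)
  show "bij (\<lambda>z. z * y)"
    by (rule bij_betw_byWitness[where f' = "\<lambda>z. z * y'"])
      (use y' in \<open>auto simp: mult.assoc mult.commute[of y' y]\<close>)
  have "(re y)\<^sup>2 + (im y)\<^sup>2 = r\<^sup>2"
    using assms(3) by (simp add: adjoin_i_eq_iff power2_eq_square)
  moreover have "sq_dist (z * y) (w * y) = ((re y)\<^sup>2 + (im y)\<^sup>2) * sq_dist z w" for z w
    unfolding sq_dist_def by (simp add: power2_eq_square algebra_simps)
  ultimately have "sq_dist (z * y) (w * y) = r\<^sup>2 * sq_dist z w" for z w by simp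
  then show "integral_dist (z * y) (w * y) = integral_dist z w" for z w
    by (simp add: integral_dist_def square_mult_square_iff[OF \<open>r \<noteq> 0\<close>])
  have "(\<lambda>z. z * y) ` line a c = line (a * y) (c * y)" for a c
    by (rule image_line) (simp add: algebra_simps)
  then show "\<exists>a' c'. (\<lambda>z. z * y) ` line a c = line a' c'" for a c by blast
qed

lemma Delta_automorphism_frobenius:
  assumes "prime p" "CARD('a::{field, finite}) = p ^ r"
  shows "Delta_automorphism (\<lambda>z :: 'a adjoin_i. AdjI (re z ^ p ^ j) (im z ^ p ^ j))"
proof -
  define F where "F = (\<lambda>x :: 'a. x ^ p ^ j)"
  note F = frobenius_facts[OF assms F_def]
  have mult: "F (x * y) = F x * F y" for x y by (simp add: F_def power_mult_distrib)
  have "Delta_automorphism (\<lambda>z. AdjI (F (re z)) (F (im z)))"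
    unfolding Delta_automorphism_iff
  proof (intro conjI allI)
    show "bij (\<lambda>z. AdjI (F (re z)) (F (im z)))"
      by (rule bij_betw_byWitness[where f' = "\<lambda>z. AdjI (inv_into UNIV F (re z)) (inv_into UNIV F (im z))"])
        (use F(3) in \<open>auto simp: bij_is_inj bij_is_surj surj_f_inv_f\<close>)
    show "integral_dist (AdjI (F (re z)) (F (im z))) (AdjI (F (re w)) (F (im w))) = integral_dist z w"
      for z w
    proof -
      have "sq_dist (AdjI (F (re z)) (F (im z))) (AdjI (F (re w)) (F (im w))) = F (sq_dist z w)"
        by (simp add: sq_dist_def F(1,2) power2_eq_square mult)
      then show ?thesis by (simp only: integral_dist_def F(4))
    qed
    have "(\<lambda>z. AdjI (F (re z)) (F (im z))) ` line a c = line (AdjI (F (re a)) (F (im a))) (AdjI (F (re c)) (F (im c)))"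
      (is "?f ` _ = line ?a ?c") for a c
    proof -
      \<comment> \<open>The parameter t becomes \<open>F t\<close>, which runs through the whole
        field.\<close>
      have "?f ` line a c = (\<lambda>t. ?a + of_base t * ?c) ` range F"
        by (simp add: line_def image_image adjoin_i_eq_iff plus_adjoin_i_def F(1) mult)
      then show ?thesis using F(3) by (simp add: line_def bij_is_surj)
    qed
    then show "\<exists>a' c'. (\<lambda>z. AdjI (F (re z)) (F (im z))) ` line a c = line a' c'" for a c by blast
  qed
  then show ?thesis by (simp add: F_def)
qed

section \<open>Decomposing an automorphism into generators\<close>

text \<open>Lagrange's identity N(u) N(v) = (u . v)^2 + D^2 gives D = n or D = -n, and orthogonality
  expresses n v through \<open>u\<close> and D. The norm must be assumed nonzero because isotropic
  vectors exist when -1 is a square.\<close>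

lemma orthogonal_same_norm:
  fixes u v :: "'a::field adjoin_i"
  assumes "re u * re v + im u * im v = 0" "(re v)\<^sup>2 + (im v)\<^sup>2 = (re u)\<^sup>2 + (im u)\<^sup>2"
    "(re u)\<^sup>2 + (im u)\<^sup>2 \<noteq> 0"
  shows "v = u * AdjI 0 1 \<or> v = - (u * AdjI 0 1)"
proof -
  define n D where "n = (re u)\<^sup>2 + (im u)\<^sup>2" and "D = re u * im v - im u * re v"
  have n: "n \<noteq> 0" using assms(3) by (simp add: n_def)
  have v: "n * re v = - im u * D" "n * im v = re u * D"
    using assms(1) unfolding n_def D_def by Groebner_Basis.algebra+
  have "D\<^sup>2 = n\<^sup>2"
    using assms(1,2) unfolding n_def D_def by Groebner_Basis.algebra
  then consider "D = n" | "D = - n" by (auto simp: power2_eq_iff)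
  then show ?thesis
  proof cases
    case 1
    with v have "n * re v = n * - im u" "n * im v = n * re u" by (simp_all add: mult.commute)
    with n have "re v = - im u" "im v = re u" by (metis mult_left_cancel)+
    then show ?thesis by (simp add: adjoin_i_eq_iff)
  next
    case 2
    with v have "n * re v = n * im u" "n * im v = n * - re u" by (simp_all add: mult.commute)
    with n have "re v = im u" "im v = - re u" by (metis mult_left_cancel)+
    then show ?thesis by (simp add: adjoin_i_eq_iff)
  qed
qed

lemma square_norm_multsI:
  assumes "(re u)\<^sup>2 + (im u)\<^sup>2 = r\<^sup>2" "r \<noteq> 0"
  shows "(\<lambda>z. z * u) \<in> square_norm_mults"
proof -
  have eq: "u * conj_i u = of_base (r\<^sup>2)"
    using assms(1) by (simp add: adjoin_i_eq_iff power2_eq_square)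
  have "1 = of_base (r\<^sup>2) * of_base (1 / r\<^sup>2)"
    using assms(2) by (simp add: adjoin_i_eq_iff)
  also have "\<dots> = u * (conj_i u * of_base (1 / r\<^sup>2))"
    unfolding eq[symmetric] by (simp only: mult.assoc)
  finally have "u dvd 1" by (rule dvdI)
  with eq assms(2) show ?thesis unfolding square_norm_mults_def by blast
qed

lemma Delta_automorphism_normal_form:
  fixes \<phi> :: "'a::{field, finite} adjoin_i \<Rightarrow> 'a adjoin_i"
  assumes p: "prime p" "p \<noteq> 2" and q: "CARD('a) = p ^ r" "CARD('a) \<noteq> 5" "CARD('a) \<noteq> 9"
    and \<phi>: "Delta_automorphism \<phi>"
  obtains s u f F where "(\<lambda>z. z * u) \<in> square_norm_mults" "F \<in> frobenius_maps p"
    "f = id \<or> f = conj_i" "\<phi> = (\<lambda>z. f (F z) * u + s)"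
proof -
  from \<phi> have "inj \<phi>" and lines: "\<And>a c. \<exists>a' c'. \<phi> ` line a c = line a' c'"
    by (auto simp: Delta_automorphism_iff bij_is_inj)
  from collineation_semilinear[OF this] obtain \<sigma> s u v
    where hom: "\<And>x y. \<sigma> (x + y) = \<sigma> x + \<sigma> y" "\<And>x y. \<sigma> (x * y) = \<sigma> x * \<sigma> y" "\<sigma> 1 = 1"
      and det: "re u * im v - im u * re v \<noteq> 0"
      and \<phi>_eq: "\<And>x y. \<phi> (AdjI x y) = of_base (\<sigma> x) * u + of_base (\<sigma> y) * v + s" by metis
  obtain j where \<sigma>: "\<sigma> = (\<lambda>x. x ^ p ^ j)"
    using ring_hom_eq_frobenius_power[OF p(1) q(1) hom] by blast
  note frob = frobenius_facts[OF p(1) q(1) \<sigma>]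
  have \<sigma>0: "\<sigma> 0 = 0" using p(1) by (simp add: \<sigma> prime_gt_0_nat)
  \<comment> \<open>The form g(x, y) = N(x u + y v), where N is the sum of the squared
    coordinates.\<close>
  define a b c where "a = (re u)\<^sup>2 + (im u)\<^sup>2" and "b = 2 * (re u * re v + im u * im v)"
    and "c = (re v)\<^sup>2 + (im v)\<^sup>2"
  have odd: "odd CARD('a)" using p q(1) by (metis even_power prime_odd_nat prime_ge_2_nat order_le_imp_less_or_eq)
  then obtain m where "CARD('a) = 2 * m + 1" by (elim oddE)
  note two = two_neq_0_of_odd_card[OF this]
  have squares: "(\<exists>t. x\<^sup>2 + y\<^sup>2 = t\<^sup>2) \<longleftrightarrow> (\<exists>t. a * x\<^sup>2 + b * x * y + c * y\<^sup>2 = t\<^sup>2)" for x y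
  proof -
    \<comment> \<open>Pulling back along \<open>\<sigma>\<close> makes g(x, y) the squared distance
      between two image points.\<close>
    from frob(3) obtain x' y' where xy: "x = \<sigma> x'" "y = \<sigma> y'" by (metis bij_is_surj surjD)
    have "(\<exists>t. x\<^sup>2 + y\<^sup>2 = t\<^sup>2) \<longleftrightarrow> (\<exists>t. \<sigma> (x'\<^sup>2 + y'\<^sup>2) = t\<^sup>2)"
      by (simp add: xy hom power2_eq_square)
    also have "\<dots> \<longleftrightarrow> (\<exists>t. x'\<^sup>2 + y'\<^sup>2 = t\<^sup>2)" by (rule frob(4))
    also have "\<dots> \<longleftrightarrow> integral_dist (AdjI x' y') (AdjI 0 0)"
      by (simp add: integral_dist_def sq_dist_def)
    also have "\<dots> \<longleftrightarrow> integral_dist (\<phi> (AdjI x' y')) (\<phi> (AdjI 0 0))"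
      using \<phi> by (simp add: Delta_automorphism_iff)
    also have "sq_dist (\<phi> (AdjI x' y')) (\<phi> (AdjI 0 0)) = a * x\<^sup>2 + b * x * y + c * y\<^sup>2"
      unfolding sq_dist_def a_def b_def c_def xy
      by (simp add: \<phi>_eq \<sigma>0 power2_eq_square algebra_simps)
    then have "integral_dist (\<phi> (AdjI x' y')) (\<phi> (AdjI 0 0)) \<longleftrightarrow> (\<exists>t. a * x\<^sup>2 + b * x * y + c * y\<^sup>2 = t\<^sup>2)"
      by (simp add: integral_dist_def)
    finally show ?thesis .
  qed
  \<comment> \<open>Lagrange's identity again: the discriminant is, up to sign, a nonzero
    square.\<close>
  have "4 * a * c - b\<^sup>2 = (2 * (re u * im v - im u * re v))\<^sup>2"
    unfolding a_def b_def c_def by Groebner_Basis.algebra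
  moreover have "2 * (re u * im v - im u * re v) \<noteq> 0" using det two by simp
  ultimately have "b = 0" "a = c"
    using same_squares_imp_proportional[OF odd q(2,3) squares] by blast+
  with \<open>4 * a * c - b\<^sup>2 = _\<close> \<open>2 * _ \<noteq> 0\<close> have "a \<noteq> 0" by auto
  \<comment> \<open>The value 1 of x^2 + y^2 at (1, 0) is a square, so N(u) is one too; this makes
    \<open>u\<close> an admissible multiplier.\<close>
  from squares[of 1 0] obtain t where "a = t\<^sup>2"
    by (simp) (metis one_power2)
  with \<open>a \<noteq> 0\<close> have "t \<noteq> 0" by auto
  have "re u * re v + im u * im v = 0" using \<open>b = 0\<close> two unfolding b_def by (metis mult_eq_0_iff)
  with \<open>a = c\<close> \<open>a \<noteq> 0\<close> have "v = u * AdjI 0 1 \<or> v = - (u * AdjI 0 1)"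
    unfolding a_def c_def by (intro orthogonal_same_norm) simp_all
  \<comment> \<open>The orientation decides: v = i u gives the identity, v = -i u gives
    conjugation.\<close>
  then obtain f where f: "f = id \<or> f = conj_i"
    and \<phi>': "\<And>z. \<phi> z = f (AdjI (re z ^ p ^ j) (im z ^ p ^ j)) * u + s"
  proof
    assume "v = u * AdjI 0 1"
    then have "\<phi> z = id (AdjI (re z ^ p ^ j) (im z ^ p ^ j)) * u + s" for z
      using \<phi>_eq[of "re z" "im z"] by (simp add: \<sigma> adjoin_i_eq_iff algebra_simps)
    then show thesis by (rule that[of id, rotated]) simp
  next
    assume "v = - (u * AdjI 0 1)"
    then have "\<phi> z = conj_i (AdjI (re z ^ p ^ j) (im z ^ p ^ j)) * u + s" for z
      using \<phi>_eq[of "re z" "im z"] by (simp add: \<sigma> adjoin_i_eq_iff algebra_simps)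
    then show thesis by (rule that[of conj_i, rotated]) simp
  qed
  show thesis
  proof
    show "(\<lambda>z. z * u) \<in> square_norm_mults"
      using \<open>a = t\<^sup>2\<close> \<open>t \<noteq> 0\<close> unfolding a_def by (rule square_norm_multsI)
    show "(\<lambda>z. AdjI (re z ^ p ^ j) (im z ^ p ^ j)) \<in> frobenius_maps p"
      unfolding frobenius_maps_def by blast
    show "f = id \<or> f = conj_i" by (fact f)
    show "\<phi> = (\<lambda>z. f (AdjI (re z ^ p ^ j) (im z ^ p ^ j)) * u + s)" by (rule ext) (fact \<phi>')
  qed
qed

theorem theorem2:
  fixes p r :: nat
    and \<phi> :: "'a::{field, finite} adjoin_i \<Rightarrow> 'a adjoin_i"
  assumes "prime p" and "p \<noteq> 2" and "r \<ge> 1"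
    and "CARD('a) = p ^ r" and "CARD('a) \<noteq> 5" and "CARD('a) \<noteq> 9"
  shows "Delta_automorphism \<phi> \<longleftrightarrow>
    finite_composition_of
      (translation_maps \<union> {swap_coords} \<union> square_norm_mults \<union> frobenius_maps p) \<phi>"
    (is "_ \<longleftrightarrow> finite_composition_of ?G \<phi>")
proof
  assume "Delta_automorphism \<phi>"
  with assms obtain s u f F where u: "(\<lambda>z. z * u) \<in> square_norm_mults" and F: "F \<in> frobenius_maps p"
    and f: "f = id \<or> f = conj_i" and \<phi>: "\<phi> = (\<lambda>z. f (F z) * u + s)"
    by (elim Delta_automorphism_normal_form)
  have s: "(\<lambda>z. z + s) \<in> translation_maps" unfolding translation_maps_def by blast
  from f show "finite_composition_of ?G \<phi>"
  proof
    assume "f = id"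
    then have "\<phi> = foldr (\<circ>) [\<lambda>z. z + s, \<lambda>z. z * u, F] id" by (simp add: \<phi> fun_eq_iff)
    moreover have "set [\<lambda>z. z + s, \<lambda>z. z * u, F] \<subseteq> ?G" using s u F by simp
    ultimately show ?thesis unfolding finite_composition_of_def by blast
  next
    assume "f = conj_i"
    \<comment> \<open>Conjugation is no generator itself, but it is the swap followed by
      multiplication by -i, which has norm 1.\<close>
    moreover have "conj_i z = swap_coords z * AdjI 0 (-1)" for z :: "'a adjoin_i"
      by (simp add: adjoin_i_eq_iff)
    ultimately have "\<phi> = foldr (\<circ>) [\<lambda>z. z + s, \<lambda>z. z * u, \<lambda>z. z * AdjI 0 (-1), swap_coords, F] id"
      by (simp add: \<phi> fun_eq_iff)
    moreover have "(\<lambda>z. z * AdjI 0 (-1 :: 'a)) \<in> square_norm_mults"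
      by (rule square_norm_multsI[of _ 1]) simp_all
    then have "set [\<lambda>z. z + s, \<lambda>z. z * u, \<lambda>z. z * AdjI 0 (-1), swap_coords, F] \<subseteq> ?G"
      using s u F by simp
    ultimately show ?thesis unfolding finite_composition_of_def by blast
  qed
next
  have gen: "Delta_automorphism g" if "g \<in> ?G" for g
    using that assms Delta_automorphism_swap_coords
    by (auto simp: translation_maps_def square_norm_mults_def frobenius_maps_def
        intro: Delta_automorphism_translation Delta_automorphism_square_norm_mult
          Delta_automorphism_frobenius)
  have "Delta_automorphism (foldr (\<circ>) fs id)" if "set fs \<subseteq> ?G" for fs
    using that by (induction fs) (simp_all add: Delta_automorphism_id Delta_automorphism_comp gen)
  moreover assume "finite_composition_of ?G \<phi>"
  ultimately show "Delta_automorphism \<phi>" unfolding finite_composition_of_def by blast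
qed

end
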